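(* For each of the following two problems, the value function is non-increasing with respect to the drift $\mu$, and the optimal price level $x_0$ is non-decreasing with respect to $\mu$: (a) (put with barrier $d$) $V(x)=\sup_{\tau\ge0}E_x[e^{-r\tau}(q-X_\tau)^+I_{\{\tau<\tau_d\}}]$, $x\in(0,d)$: if $\mu_1(x)\le\mu_2(x)$ for all $x\in(0,d)$, then $V_{\mu_1}(x)\ge V_{\mu_2}(x)$; (b) (standard American put) $V(x)=\sup_{\tau\ge0}E_x[e^{-r\tau}(q-X_\tau)^+I_{\{\tau<\infty\}}]$, $x\in(0,+\infty)$: the same, with $(0,d)$ replaced by $(0,+\infty)$. Here $V_{\mu_i}$ denotes the value function with drift $\mu_i$, all other data being equal.
   Context: Let $\mathcal I=(0,+\infty)$ and let $r>0$ be a constant. On a complete probability space with filtration $(\mathcal F_t)_{t\ge0}$ and an adapted standard one-dimensional Brownian motion $B$, the process $X$ with state space $\mathcal I$ satisfies $dX_t=\mu(X_t)dt+\sigma(X_t)dB_t$, $X_0=x\in\mathcal I$; $E_x=E[\cdot\mid X_0=x]$. Standing assumptions (for all coefficients considered): (i) $\mu:\mathcal I\to\mathbb R$ and $\sigma:\mathcal I\to(0,+\infty)$ are measurable and the SDE has a unique strong solution; (ii) $\theta(x)=rx-\mu(x)$ is non-decreasing on $\mathcal I$; (iii) $X$ is regular in $\mathcal I$ (every point of $\mathcal I$ is reached from every other with positive probability) and $0$ is a natural boundary. Let $\mathcal L=\frac12\sigma^2(x)\frac{d^2}{dx^2}+\mu(x)\frac{d}{dx}$. $\psi$ (resp. $\varphi$)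 denotes the positive strictly increasing (resp. strictly decreasing) $C^2$ solution, determined up to a positive factor, of $(\mathcal L-r)u=0$ on $\mathcal I$ such that, with $\tau_\kappa=\inf\{t\ge0:X_t=\kappa\}$, $E_x[e^{-r\tau_\kappa}]=\psi(x)/\psi(\kappa)$ for $x\le\kappa$ and $E_x[e^{-r\tau_\kappa}]=\varphi(x)/\varphi(\kappa)$ for $x\ge\kappa$. In this setting $\psi(0+)=0$, $\varphi(0+)=+\infty$, $\varphi(+\infty)=0$, and $F=\psi/\varphi$ is a strictly increasing bijection of $\mathcal I$ onto $(0,+\infty)$. It is further assumed that $\varphi$ is convex on $(0,+\infty)$. $d>q>0$ are constants (barrier and strike), $\tau_d=\inf\{t\ge0:X_t=d\}$, $h(x)=(q-x)^+$, and suprema are over $(\mathcal F_t)$-stopping times. In (a), $x_0\in(0,q)$ is the unique solution of $\frac{(h'\psi-h\psi')(x_0)}{F(d)}=(h'\varphi-h\varphi')(x_0)$, and $V(x)=q-x$ for $0<x\le x_0$, $V(x)=(q-x_0)\frac{\varphi(x)}{\varphi(x_0)}\frac{F(d)-F(x)}{F(d)-F(x_0)}$ for $x_0<x<d$. In (b), $x_0\in(0,q)$ is the unique solution of $\varphi(x_0)+(q-x_0)\varphi'(x_0)=0$, and $V(x)=q-x$ for $0<x\le x_0$, $V(x)=(q-x_0)\varphi(x)/\varphi(x_0)$ for $x>x_0$. In both cases the stopping region $\{V=h\}$ is $(0,x_0]$. *)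

theory Defs
  imports "HOL-Probability.Probability"
begin

text \<open>
  Processes are functions of time and outcome; only times \<open>t \<ge> 0\<close> matter.  Filtrations are indexed by
  \<^typ>\<open>ennreal\<close>, so that the \<^const>\<open>stopping_time\<close> of the library ranges over
  \<open>[0, \<infinity>]\<close>-valued times; its condition at \<open>t = \<infinity>\<close> is void.  The state space is \<open>{0<..}\<close>, and values
  of the coefficients outside it are irrelevant.
\<close>

subsection \<open>Brownian motion and the stochastic integral\<close>

locale brownian_space = prob_space M + complete_measure M + filtration "space M" F
  for M :: "'w measure" and F :: "ennreal \<Rightarrow> 'w measure" +
  fixes B :: "real \<Rightarrow> 'w \<Rightarrow> real"
  assumes sets_F_subset: "sets (F t) \<subseteq> sets M"
    and B_adapted: "0 \<le> t \<Longrightarrow> B t \<in> borel_measurable (F (ennreal t))"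
    and B_zero: "AE \<omega> in M. B 0 \<omega> = 0"
    and B_continuous: "AE \<omega> in M. continuous_on {0..} (\<lambda>t. B t \<omega>)"
    and B_increment_normal: "0 \<le> s \<Longrightarrow> s < t \<Longrightarrow>
      distributed M lborel (\<lambda>\<omega>. B t \<omega> - B s \<omega>) (\<lambda>z. ennreal (normal_density 0 (sqrt (t - s)) z))"
    and B_increment_indep: "0 \<le> s \<Longrightarrow> s < t \<Longrightarrow>
      indep_set (sets (F (ennreal s))) {(\<lambda>\<omega>. B t \<omega> - B s \<omega>) -` A \<inter> space M | A. A \<in> sets borel}"

definition augmented_brownian_filtration ::
  "'w measure \<Rightarrow> (real \<Rightarrow> 'w \<Rightarrow> real) \<Rightarrow> real \<Rightarrow> 'w measure" where
  "augmented_brownian_filtration M B t =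
     sigma (space M)
       ({B s -` A \<inter> space M | s A. 0 \<le> s \<and> s \<le> t \<and> A \<in> sets borel} \<union> null_sets M)"

definition tends_in_probability_0 :: "'w measure \<Rightarrow> (nat \<Rightarrow> 'w \<Rightarrow> ennreal) \<Rightarrow> bool" where
  "tends_in_probability_0 M Y \<longleftrightarrow>
     (\<forall>k. Y k \<in> borel_measurable M) \<and>
     (\<forall>e>0. (\<lambda>k. measure M {\<omega> \<in> space M. ennreal e < Y k \<omega>}) \<longlonglongrightarrow> 0)"

text \<open>
  The data \<open>n\<close>, \<open>p\<close>, \<open>\<xi>\<close> encode the simple integrand
  \<open>\<Sum>i<n. \<xi> i * indicator {p i<..p (Suc i)}\<close> with bounded \<open>F (p i)\<close>-measurable \<open>\<xi> i\<close>.
\<close>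

definition simple_integrand ::
  "(ennreal \<Rightarrow> 'w measure) \<Rightarrow> nat \<Rightarrow> (nat \<Rightarrow> real) \<Rightarrow> (nat \<Rightarrow> 'w \<Rightarrow> real) \<Rightarrow> bool" where
  "simple_integrand F n p \<xi> \<longleftrightarrow>
     0 \<le> p 0 \<and>
     (\<forall>i<n. p i \<le> p (Suc i)) \<and>
     (\<forall>i<n. \<xi> i \<in> borel_measurable (F (ennreal (p i)))) \<and>
     (\<forall>i<n. \<exists>C. \<forall>\<omega>\<in>space (F (ennreal (p i))). \<bar>\<xi> i \<omega>\<bar> \<le> C)"

definition simple_process :: "nat \<Rightarrow> (nat \<Rightarrow> real) \<Rightarrow> (nat \<Rightarrow> 'w \<Rightarrow> real) \<Rightarrow> real \<Rightarrow> 'w \<Rightarrow> real" where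
  "simple_process n p \<xi> s \<omega> = (\<Sum>i<n. \<xi> i \<omega> * indicator {p i<..p (Suc i)} s)"

definition simple_ito_integral ::
  "(real \<Rightarrow> 'w \<Rightarrow> real) \<Rightarrow> nat \<Rightarrow> (nat \<Rightarrow> real) \<Rightarrow> (nat \<Rightarrow> 'w \<Rightarrow> real) \<Rightarrow> real \<Rightarrow> 'w \<Rightarrow> real" where
  "simple_ito_integral B n p \<xi> t \<omega> =
     (\<Sum>i<n. \<xi> i \<omega> * (B (min (p (Suc i)) t) \<omega> - B (min (p i) t) \<omega>))"

text \<open>
  \<open>I\<close> is (a version of) the process \<open>t \<mapsto> \<integral>\<^sub>0\<^sup>t H dB\<close> for a locally square integrable
  integrand \<open>H\<close>: simple integrands approximate \<open>H\<close> in \<open>L\<^sup>2([0, T])\<close> in probability, for all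
  \<open>T\<close>, and their elementary integrals converge to \<open>I\<close> uniformly on \<open>[0, T]\<close> in probability.
\<close>

definition has_ito_integral ::
  "'w measure \<Rightarrow> (ennreal \<Rightarrow> 'w measure) \<Rightarrow> (real \<Rightarrow> 'w \<Rightarrow> real) \<Rightarrow>
   (real \<Rightarrow> 'w \<Rightarrow> real) \<Rightarrow> (real \<Rightarrow> 'w \<Rightarrow> real) \<Rightarrow> bool" where
  "has_ito_integral M F B H I \<longleftrightarrow>
     (\<forall>t\<ge>0. I t \<in> borel_measurable M) \<and>
     (AE \<omega> in M. continuous_on {0..} (\<lambda>t. I t \<omega>)) \<and>
     (\<exists>n p \<xi>.
        (\<forall>k. simple_integrand F (n k) (p k) (\<xi> k)) \<and>
        (\<forall>T\<ge>0.
           tends_in_probability_0 M (\<lambda>k \<omega>.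
             \<integral>\<^sup>+ s \<in> {0..T}. ennreal ((simple_process (n k) (p k) (\<xi> k) s \<omega> - H s \<omega>)\<^sup>2) \<partial>lborel) \<and>
           tends_in_probability_0 M (\<lambda>k \<omega>.
             SUP t\<in>{0..T}. ennreal \<bar>simple_ito_integral B (n k) (p k) (\<xi> k) t \<omega> - I t \<omega>\<bar>)))"

subsection \<open>The diffusion\<close>

text \<open>
  A strong solution is adapted to the augmented filtration of \<open>B\<close>.  Adaptedness to \<open>F\<close> is a separate
  condition because \<open>F\<close> is not assumed to contain the null sets.
\<close>

definition strong_solution ::
  "'w measure \<Rightarrow> (ennreal \<Rightarrow> 'w measure) \<Rightarrow> (real \<Rightarrow> 'w \<Rightarrow> real) \<Rightarrow>
   (real \<Rightarrow> real) \<Rightarrow> (real \<Rightarrow> real) \<Rightarrow> real \<Rightarrow> (real \<Rightarrow> 'w \<Rightarrow> real) \<Rightarrow> bool" where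
  "strong_solution M F B \<mu> \<sigma> x X \<longleftrightarrow>
     (\<forall>t\<ge>0. X t \<in> borel_measurable (F (ennreal t))) \<and>
     (\<forall>t\<ge>0. X t \<in> borel_measurable (augmented_brownian_filtration M B t)) \<and>
     (AE \<omega> in M. continuous_on {0..} (\<lambda>t. X t \<omega>) \<and> (\<forall>t\<ge>0. 0 < X t \<omega>)) \<and>
     (\<exists>I. has_ito_integral M F B (\<lambda>s \<omega>. \<sigma> (X s \<omega>)) I \<and>
        (AE \<omega> in M. \<forall>t\<ge>0.
           set_integrable lborel {0..t} (\<lambda>s. \<mu> (X s \<omega>)) \<and>
           X t \<omega> = x + (LINT s:{0..t}|lborel. \<mu> (X s \<omega>)) + I t \<omega>))"

definition unique_strong_solution ::
  "'w measure \<Rightarrow> (ennreal \<Rightarrow> 'w measure) \<Rightarrow> (real \<Rightarrow> 'w \<Rightarrow> real) \<Rightarrow>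
   (real \<Rightarrow> real) \<Rightarrow> (real \<Rightarrow> real) \<Rightarrow> real \<Rightarrow> (real \<Rightarrow> 'w \<Rightarrow> real) \<Rightarrow> bool" where
  "unique_strong_solution M F B \<mu> \<sigma> x X \<longleftrightarrow>
     strong_solution M F B \<mu> \<sigma> x X \<and>
     (\<forall>Y. strong_solution M F B \<mu> \<sigma> x Y \<longrightarrow> (AE \<omega> in M. \<forall>t\<ge>0. Y t \<omega> = X t \<omega>))"

definition hitting_time :: "(real \<Rightarrow> 'w \<Rightarrow> real) \<Rightarrow> real \<Rightarrow> 'w \<Rightarrow> ennreal" where
  "hitting_time X y \<omega> = Inf {ennreal t | t. 0 \<le> t \<and> X t \<omega> = y}"

definition discount :: "real \<Rightarrow> ennreal \<Rightarrow> real" where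
  "discount r t = (if t = \<infinity> then 0 else exp (- r * enn2real t))"

text \<open>
  Feller's classification: \<open>0\<close> is natural iff it is neither an exit nor an entrance boundary, i.e. iff
  both iterated integrals of the scale density \<open>s\<close> and the speed density \<open>2 / (\<sigma>\<^sup>2 s)\<close> near
  \<open>0\<close> diverge.  The test presupposes local integrability of \<open>2 \<mu> / \<sigma>\<^sup>2\<close> on \<open>{0<..}\<close>,
  which holds in \<open>put_diffusion\<close> below: the two \<open>C\<^sup>2\<close> solutions of the homogeneous equation force
  \<open>\<mu> / \<sigma>\<^sup>2\<close> and \<open>1 / \<sigma>\<^sup>2\<close> to be continuous.
\<close>

definition scale_density :: "(real \<Rightarrow> real) \<Rightarrow> (real \<Rightarrow> real) \<Rightarrow> real \<Rightarrow> real \<Rightarrow> real" where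
  "scale_density \<mu> \<sigma> c x = exp (- (LBINT y=ereal c..ereal x. 2 * \<mu> y / (\<sigma> y)\<^sup>2))"

definition speed_density :: "(real \<Rightarrow> real) \<Rightarrow> (real \<Rightarrow> real) \<Rightarrow> real \<Rightarrow> real \<Rightarrow> real" where
  "speed_density \<mu> \<sigma> c x = 2 / ((\<sigma> x)\<^sup>2 * scale_density \<mu> \<sigma> c x)"

definition natural_boundary_0 :: "(real \<Rightarrow> real) \<Rightarrow> (real \<Rightarrow> real) \<Rightarrow> bool" where
  "natural_boundary_0 \<mu> \<sigma> \<longleftrightarrow> (\<forall>c>0.
     (\<integral>\<^sup>+ a \<in> {0<..<c}. (\<integral>\<^sup>+ y \<in> {a<..<c}. ennreal (speed_density \<mu> \<sigma> c y) \<partial>lborel)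
        * ennreal (scale_density \<mu> \<sigma> c a) \<partial>lborel) = \<infinity> \<and>
     (\<integral>\<^sup>+ a \<in> {0<..<c}. (\<integral>\<^sup>+ y \<in> {a<..<c}. ennreal (scale_density \<mu> \<sigma> c y) \<partial>lborel)
        * ennreal (speed_density \<mu> \<sigma> c a) \<partial>lborel) = \<infinity>)"

definition C2_on_pos :: "(real \<Rightarrow> real) \<Rightarrow> bool" where
  "C2_on_pos u \<longleftrightarrow>
     (\<forall>x>0. u field_differentiable at x) \<and>
     (\<forall>x>0. deriv u field_differentiable at x) \<and>
     continuous_on {0<..} (deriv (deriv u))"

definition generator :: "(real \<Rightarrow> real) \<Rightarrow> (real \<Rightarrow> real) \<Rightarrow> (real \<Rightarrow> real) \<Rightarrow> real \<Rightarrow> real" where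
  "generator \<mu> \<sigma> u x = (\<sigma> x)\<^sup>2 / 2 * deriv (deriv u) x + \<mu> x * deriv u x"

text \<open>\<open>X x\<close> is the solution started at \<open>x\<close>; expectations \<open>E\<^sub>x\<close> are integrals of functionals of \<open>X x\<close>.\<close>

locale put_diffusion = brownian_space M F B
  for M :: "'w measure" and F :: "ennreal \<Rightarrow> 'w measure" and B :: "real \<Rightarrow> 'w \<Rightarrow> real" +
  fixes r :: real
    and \<sigma> \<mu> :: "real \<Rightarrow> real"
    and X :: "real \<Rightarrow> real \<Rightarrow> 'w \<Rightarrow> real"
    and \<psi> \<phi> :: "real \<Rightarrow> real"
  assumes r_pos: "0 < r"
    and mu_measurable: "\<mu> \<in> borel_measurable (restrict_space borel {0<..})"
    and sigma_measurable: "\<sigma> \<in> borel_measurable (restrict_space borel {0<..})"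
    and sigma_pos: "0 < x \<Longrightarrow> 0 < \<sigma> x"
    and X_solution: "0 < x \<Longrightarrow> unique_strong_solution M F B \<mu> \<sigma> x (X x)"
    and theta_mono: "mono_on {0<..} (\<lambda>x. r * x - \<mu> x)"
    and X_regular: "0 < x \<Longrightarrow> 0 < y \<Longrightarrow> 0 < prob {\<omega> \<in> space M. hitting_time (X x) y \<omega> < \<infinity>}"
    and zero_natural: "natural_boundary_0 \<mu> \<sigma>"
    and psi_C2: "C2_on_pos \<psi>"
    and psi_pos: "0 < x \<Longrightarrow> 0 < \<psi> x"
    and psi_increasing: "strict_mono_on {0<..} \<psi>"
    and psi_ode: "0 < x \<Longrightarrow> generator \<mu> \<sigma> \<psi> x - r * \<psi> x = 0"
    and psi_hitting: "0 < x \<Longrightarrow> x \<le> \<kappa> \<Longrightarrow>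
      (\<integral>\<omega>. discount r (hitting_time (X x) \<kappa> \<omega>) \<partial>M) = \<psi> x / \<psi> \<kappa>"
    and phi_C2: "C2_on_pos \<phi>"
    and phi_pos: "0 < x \<Longrightarrow> 0 < \<phi> x"
    and phi_decreasing: "strict_antimono_on {0<..} \<phi>"
    and phi_ode: "0 < x \<Longrightarrow> generator \<mu> \<sigma> \<phi> x - r * \<phi> x = 0"
    and phi_hitting: "0 < \<kappa> \<Longrightarrow> \<kappa> \<le> x \<Longrightarrow>
      (\<integral>\<omega>. discount r (hitting_time (X x) \<kappa> \<omega>) \<partial>M) = \<phi> x / \<phi> \<kappa>"
    and psi_at_0: "(\<psi> \<longlongrightarrow> 0) (at_right 0)"
    and phi_at_0: "filterlim \<phi> at_top (at_right 0)"
    and phi_at_infinity: "(\<phi> \<longlongrightarrow> 0) at_top"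
    and F_increasing: "strict_mono_on {0<..} (\<lambda>x. \<psi> x / \<phi> x)"
    and F_bij: "bij_betw (\<lambda>x. \<psi> x / \<phi> x) {0<..} {0<..}"
    and phi_convex: "convex_on {0<..} \<phi>"

subsection \<open>The optimal stopping problems\<close>

definition put_payoff :: "real \<Rightarrow> real \<Rightarrow> real" where
  "put_payoff q x = max (q - x) 0"

definition barrier_put_value ::
  "'w measure \<Rightarrow> (ennreal \<Rightarrow> 'w measure) \<Rightarrow> real \<Rightarrow> (real \<Rightarrow> real \<Rightarrow> 'w \<Rightarrow> real) \<Rightarrow>
   real \<Rightarrow> real \<Rightarrow> real \<Rightarrow> real" where
  "barrier_put_value M F r X q d x =
     (SUP \<tau> \<in> {\<tau>. stopping_time F \<tau>}.
        \<integral>\<omega>. (if \<tau> \<omega> < hitting_time (X x) d \<omega>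
             then discount r (\<tau> \<omega>) * put_payoff q (X x (enn2real (\<tau> \<omega>)) \<omega>) else 0) \<partial>M)"

definition american_put_value ::
  "'w measure \<Rightarrow> (ennreal \<Rightarrow> 'w measure) \<Rightarrow> real \<Rightarrow> (real \<Rightarrow> real \<Rightarrow> 'w \<Rightarrow> real) \<Rightarrow>
   real \<Rightarrow> real \<Rightarrow> real" where
  "american_put_value M F r X q x =
     (SUP \<tau> \<in> {\<tau>. stopping_time F \<tau>}.
        \<integral>\<omega>. (if \<tau> \<omega> < \<infinity>
             then discount r (\<tau> \<omega>) * put_payoff q (X x (enn2real (\<tau> \<omega>)) \<omega>) else 0) \<partial>M)"

definition barrier_put_equation ::
  "real \<Rightarrow> real \<Rightarrow> (real \<Rightarrow> real) \<Rightarrow> (real \<Rightarrow> real) \<Rightarrow> real \<Rightarrow> bool" where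
  "barrier_put_equation q d \<psi> \<phi> y \<longleftrightarrow>
     (deriv (put_payoff q) y * \<psi> y - put_payoff q y * deriv \<psi> y) / (\<psi> d / \<phi> d)
       = deriv (put_payoff q) y * \<phi> y - put_payoff q y * deriv \<phi> y"

definition barrier_put_level ::
  "real \<Rightarrow> real \<Rightarrow> (real \<Rightarrow> real) \<Rightarrow> (real \<Rightarrow> real) \<Rightarrow> real \<Rightarrow> bool" where
  "barrier_put_level q d \<psi> \<phi> x0 \<longleftrightarrow>
     x0 \<in> {0<..<q} \<and> barrier_put_equation q d \<psi> \<phi> x0 \<and>
     (\<forall>y\<in>{0<..<q}. barrier_put_equation q d \<psi> \<phi> y \<longrightarrow> y = x0)"

definition barrier_put_formula ::
  "real \<Rightarrow> real \<Rightarrow> (real \<Rightarrow> real) \<Rightarrow> (real \<Rightarrow> real) \<Rightarrow> real \<Rightarrow> real \<Rightarrow> real" where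
  "barrier_put_formula q d \<psi> \<phi> x0 x =
     (if x \<le> x0 then q - x
      else (q - x0) * (\<phi> x / \<phi> x0) *
           ((\<psi> d / \<phi> d - \<psi> x / \<phi> x) / (\<psi> d / \<phi> d - \<psi> x0 / \<phi> x0)))"

definition american_put_equation :: "real \<Rightarrow> (real \<Rightarrow> real) \<Rightarrow> real \<Rightarrow> bool" where
  "american_put_equation q \<phi> y \<longleftrightarrow> \<phi> y + (q - y) * deriv \<phi> y = 0"

definition american_put_level :: "real \<Rightarrow> (real \<Rightarrow> real) \<Rightarrow> real \<Rightarrow> bool" where
  "american_put_level q \<phi> x0 \<longleftrightarrow>
     x0 \<in> {0<..<q} \<and> american_put_equation q \<phi> x0 \<and>
     (\<forall>y\<in>{0<..<q}. american_put_equation q \<phi> y \<longrightarrow> y = x0)"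

definition american_put_formula :: "real \<Rightarrow> (real \<Rightarrow> real) \<Rightarrow> real \<Rightarrow> real \<Rightarrow> real" where
  "american_put_formula q \<phi> x0 x =
     (if x \<le> x0 then q - x else (q - x0) * (\<phi> x / \<phi> x0))"

end

theory Submission
  imports Defs
begin

text \<open>
  The closed forms of the two value functions turn the proposition into a statement about solutions of
  \<open>generator \<mu> \<sigma> p = r p\<close>.  The barrier problem is a disguised American put: the decreasing solution
  \<open>p = \<phi> - (\<phi> d / \<psi> d) \<psi>\<close>, which vanishes at \<open>d\<close>, takes the role of \<open>\<phi>\<close> both in the equation for the
  level (\<open>barrier_put_level_iff_american\<close>) and in the value (\<open>barrier_put_formula_eq_american\<close>).

  For such a \<open>p\<close> the ratio \<open>p x / p y\<close> with \<open>y \<le> x\<close> is the expected discount until the process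
  started at \<open>x\<close> comes down to \<open>y\<close> (before \<open>d\<close>).  A larger drift delays this event, so the ratio falls.
  Analytically: \<open>p2\<close> is decreasing, hence
  \<open>generator \<mu>1 \<sigma> p2 - r p2 = (\<mu>1 - \<mu>2) p2' \<ge> 0\<close>, and the maximum principle bounds \<open>p2 / p2 y\<close> by
  \<open>p1 / p1 y\<close> to the right of \<open>y\<close> (\<open>generator_comparison\<close>).  In other words \<open>p1 / p2\<close> is
  non-decreasing.

  The level \<open>x0\<close> is the only critical point of \<open>g y = (q - y) / p y\<close>, which vanishes at \<open>0\<close> and at \<open>q\<close>;
  so \<open>g\<close> increases strictly up to \<open>x0\<close> and decreases strictly afterwards.  Thus, to the right of \<open>x0\<close>, the value
  \<open>p x * g x0\<close> is the best result of waiting for a fixed level.  As \<open>g1 = g2 * (p2 / p1)\<close> is the product of \<open>g2\<close> and a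
  non-increasing function, \<open>g1\<close> already decreases where \<open>g2\<close> does, which orders the maximizers;
  and using the second level in the first problem is at least as good as in the second problem, which orders
  the values (\<open>american_put_formula_comparison\<close>).
\<close>

section \<open>Linear combinations of \<open>C\<^sup>2\<close> functions\<close>

lemma deriv_lincomb:
  fixes u v :: "real \<Rightarrow> real"
  assumes "u field_differentiable at x" "v field_differentiable at x"
  shows "deriv (\<lambda>y. \<alpha> * u y + \<beta> * v y) x = \<alpha> * deriv u x + \<beta> * deriv v x"
  using assms by (intro DERIV_imp_deriv)
    (intro DERIV_add DERIV_cmult field_differentiable_derivI)

lemma deriv_deriv_lincomb:
  fixes u v :: "real \<Rightarrow> real"
  assumes "C2_on_pos u" "C2_on_pos v" "0 < x"
  shows "((deriv (\<lambda>y. \<alpha> * u y + \<beta> * v y)) has_field_derivative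
           \<alpha> * deriv (deriv u) x + \<beta> * deriv (deriv v) x) (at x)"
proof -
  have "((\<lambda>y. \<alpha> * deriv u y + \<beta> * deriv v y) has_field_derivative
           \<alpha> * deriv (deriv u) x + \<beta> * deriv (deriv v) x) (at x)"
    using assms unfolding C2_on_pos_def
    by (intro DERIV_add DERIV_cmult field_differentiable_derivI) auto
  moreover have "eventually (\<lambda>y. y \<in> {0<..}) (nhds x)"
    using assms(3) by (intro eventually_nhds_in_open) auto
  then have ev: "eventually (\<lambda>y. deriv (\<lambda>y. \<alpha> * u y + \<beta> * v y) y = \<alpha> * deriv u y + \<beta> * deriv v y) (nhds x)"
    by eventually_elim (rule deriv_lincomb; use assms in \<open>simp add: C2_on_pos_def\<close>)
  ultimately show ?thesis
    by (simp only: DERIV_cong_ev[OF refl ev refl])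
qed

lemma C2_on_pos_lincomb:
  assumes "C2_on_pos u" "C2_on_pos v"
  shows "C2_on_pos (\<lambda>y. \<alpha> * u y + \<beta> * v y)"
proof -
  have "continuous_on {0<..} (\<lambda>x. \<alpha> * deriv (deriv u) x + \<beta> * deriv (deriv v) x)"
    using assms unfolding C2_on_pos_def by (intro continuous_intros) auto
  then have "continuous_on {0<..} (deriv (deriv (\<lambda>y. \<alpha> * u y + \<beta> * v y)))"
    by (rule continuous_on_eq)
      (use DERIV_imp_deriv[OF deriv_deriv_lincomb[OF assms], symmetric] in auto)
  moreover have "(\<lambda>y. \<alpha> * u y + \<beta> * v y) field_differentiable at x" if "0 < x" for x
    using assms that unfolding C2_on_pos_def
    by (intro field_differentiable_add field_differentiable_mult field_differentiable_const) auto
  moreover have "deriv (\<lambda>y. \<alpha> * u y + \<beta> * v y) field_differentiable at x" if "0 < x" for x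
    using deriv_deriv_lincomb[OF assms that] unfolding field_differentiable_def by blast
  ultimately show ?thesis
    unfolding C2_on_pos_def by blast
qed

lemma generator_lincomb:
  assumes "C2_on_pos u" "C2_on_pos v" "0 < x"
  shows "generator \<mu> \<sigma> (\<lambda>y. \<alpha> * u y + \<beta> * v y) x = \<alpha> * generator \<mu> \<sigma> u x + \<beta> * generator \<mu> \<sigma> v x"
proof -
  have "deriv (\<lambda>y. \<alpha> * u y + \<beta> * v y) x = \<alpha> * deriv u x + \<beta> * deriv v x"
    using assms by (intro deriv_lincomb) (auto simp: C2_on_pos_def)
  then show ?thesis
    unfolding generator_def DERIV_imp_deriv[OF deriv_deriv_lincomb[OF assms]] by algebra
qed

section \<open>Comparison of solutions for ordered drifts\<close>

text \<open>
  If the second derivative were positive, the first derivative would be positive just to the right of the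
  critical point, and the function would rise there.
\<close>

lemma second_deriv_nonpos_at_max:
  fixes w :: "real \<Rightarrow> real"
  assumes "a < c" "c < b"
    and diff: "\<And>x. a < x \<Longrightarrow> x < b \<Longrightarrow> w field_differentiable at x"
    and diff2: "deriv w field_differentiable at c"
    and max: "\<And>x. a < x \<Longrightarrow> x < b \<Longrightarrow> w x \<le> w c"
  shows "deriv w c = 0" "deriv (deriv w) c \<le> 0"
proof -
  have D: "(w has_real_derivative deriv w x) (at x)" if "a < x" "x < b" for x
    using diff[OF that] by (simp add: field_differentiable_derivI)
  show *: "deriv w c = 0"
    by (rule DERIV_local_max[OF D[OF assms(1,2)], of "min (c - a) (b - c)"])
      (use assms in \<open>auto simp: abs_if split: if_splits\<close>)
  show "deriv (deriv w) c \<le> 0"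
  proof (rule ccontr)
    assume "\<not> ?thesis"
    then obtain e where e: "e > 0" "\<And>h. 0 < h \<Longrightarrow> h < e \<Longrightarrow> deriv w c < deriv w (c + h)"
      using DERIV_pos_inc_right[of "deriv w" "deriv (deriv w) c" c] diff2
      by (auto simp: field_differentiable_derivI)
    define h where "h = min e (b - c) / 2"
    have h: "0 < h" "h < e" "c + h < b"
      using e(1) assms(2) by (auto simp: h_def min_def field_simps)
    have "w c < w (c + h)"
    proof (rule DERIV_pos_imp_increasing_open[where f = w])
      fix x assume "c < x" "x < c + h"
      with e(2)[of "x - c"] h * assms(1) D[of x] show "\<exists>y. DERIV w x :> y \<and> y > 0"
        by (intro exI[of _ "deriv w x"]) auto
    next
      show "continuous_on {c..c + h} w"
        using h assms(1) by (intro continuous_at_imp_continuous_on ballI DERIV_isCont[OF D]) auto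
    qed (use h in auto)
    then show False
      using max[of "c + h"] h assms(1) by auto
  qed
qed

text \<open>
  At an interior maximum the generator is at most \<open>0\<close>, whereas a value above \<open>K \<ge> 0\<close> would make
  its lower bound \<open>r * w\<close> positive.  The slack \<open>K\<close> covers unbounded intervals, on which \<open>w\<close> is only known to become small.
\<close>

lemma generator_maximum_principle:
  assumes "0 < r" "0 < a" and C2: "C2_on_pos w"
    and sub: "\<And>x. a < x \<Longrightarrow> x < b \<Longrightarrow> r * w x \<le> generator \<mu> \<sigma> w x"
    and bd: "w a \<le> K" "w b \<le> K" "0 \<le> K"
    and x: "a \<le> x" "x \<le> b"
  shows "w x \<le> K"
proof -
  have "continuous_on {a..b} w"
    using C2 \<open>0 < a\<close> unfolding C2_on_pos_def
    by (intro continuous_at_imp_continuous_on ballI field_differentiable_imp_continuous_at) auto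
  then obtain c where c: "c \<in> {a..b}" "\<And>y. y \<in> {a..b} \<Longrightarrow> w y \<le> w c"
    using continuous_attains_sup[of "{a..b}" w] x by auto
  have "w c \<le> K"
  proof (rule ccontr)
    assume "\<not> w c \<le> K"
    then have "a < c" "c < b" "0 < w c"
      using bd c(1) by (auto simp: order.order_iff_strict)
    moreover from this have "deriv w c = 0" "deriv (deriv w) c \<le> 0"
      using C2 c \<open>0 < a\<close> unfolding C2_on_pos_def
      by (intro second_deriv_nonpos_at_max[of a c b w]; simp)+
    ultimately have "generator \<mu> \<sigma> w c \<le> 0" "0 < r * w c"
      using \<open>0 < r\<close> by (auto simp: generator_def mult_nonneg_nonpos)
    then show False
      using sub[OF \<open>a < c\<close> \<open>c < b\<close>] by linarith
  qed
  with c(2)[of x] x show ?thesis by auto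
qed

lemma deriv_nonpos_of_antimono:
  fixes p :: "real \<Rightarrow> real"
  assumes "strict_antimono_on {0<..} p" "p field_differentiable at x" "0 < x"
  shows "deriv p x \<le> 0"
proof -
  have "mono_on {0<..} (\<lambda>y. - p y)"
    using assms(1) by (force simp: monotone_on_def order.order_iff_strict)
  moreover have "((\<lambda>y. - p y) has_field_derivative - deriv p x) (at x)"
    using assms(2) by (auto intro!: derivative_intros simp: field_differentiable_derivI)
  ultimately have "- deriv p x \<ge> 0"
    using mono_on_imp_deriv_nonneg[of "{0<..}" "\<lambda>y. - p y" "- deriv p x" x] assms(3)
    by (auto simp: interior_open)
  then show ?thesis by simp
qed

text \<open>
  \<open>p2\<close> is a subsolution for the smaller drift because it is decreasing, so the maximum principle applies
  to the difference of the solutions normalised at \<open>a\<close>.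
\<close>

lemma generator_comparison:
  assumes "0 < r" "0 < a"
    and p1: "C2_on_pos p1" "\<And>x. 0 < x \<Longrightarrow> generator \<mu>1 \<sigma> p1 x = r * p1 x" "0 < p1 a"
    and p2: "C2_on_pos p2" "\<And>x. 0 < x \<Longrightarrow> generator \<mu>2 \<sigma> p2 x = r * p2 x" "0 < p2 a"
      "strict_antimono_on {0<..} p2"
    and drift: "\<And>x. a < x \<Longrightarrow> x < b \<Longrightarrow> \<mu>1 x \<le> \<mu>2 x"
    and bd: "p2 b / p2 a \<le> p1 b / p1 a + K" "0 \<le> K"
    and x: "a \<le> x" "x \<le> b"
  shows "p2 x / p2 a \<le> p1 x / p1 a + K"
proof -
  define w where "w = (\<lambda>y. (1 / p2 a) * p2 y + (- 1 / p1 a) * p1 y)"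
  have "w x \<le> K"
  proof (rule generator_maximum_principle[where w = w and \<mu> = \<mu>1 and \<sigma> = \<sigma> and a = a and b = b])
    show "C2_on_pos w"
      unfolding w_def by (intro C2_on_pos_lincomb p1 p2)
    show "r * w y \<le> generator \<mu>1 \<sigma> w y" if y: "a < y" "y < b" for y
    proof -
      have pos: "0 < y" using y \<open>0 < a\<close> by simp
      have "generator \<mu>1 \<sigma> p2 y = generator \<mu>2 \<sigma> p2 y + (\<mu>1 y - \<mu>2 y) * deriv p2 y"
        by (simp add: generator_def algebra_simps)
      moreover have "deriv p2 y \<le> 0"
        using p2 pos by (intro deriv_nonpos_of_antimono) (auto simp: C2_on_pos_def)
      then have "0 \<le> (\<mu>1 y - \<mu>2 y) * deriv p2 y"
        using drift[OF y] by (intro mult_nonpos_nonpos) auto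
      ultimately have "r * p2 y \<le> generator \<mu>1 \<sigma> p2 y"
        using p2(2)[OF pos] by simp
      then have "(1 / p2 a) * (r * p2 y) \<le> (1 / p2 a) * generator \<mu>1 \<sigma> p2 y"
        using p2(3) by (intro mult_left_mono) auto
      moreover have "generator \<mu>1 \<sigma> w y
          = (1 / p2 a) * generator \<mu>1 \<sigma> p2 y + (- 1 / p1 a) * (r * p1 y)"
        unfolding w_def generator_lincomb[OF p2(1) p1(1) pos] p1(2)[OF pos] ..
      ultimately show ?thesis
        by (simp add: w_def algebra_simps)
    qed
  qed (use assms in \<open>auto simp: w_def\<close>)
  then show ?thesis by (simp add: w_def)
qed

section \<open>The American put formula for a decreasing solution\<close>

text \<open>By Rolle the function is injective, hence monotone, and its end values decide the direction.\<close>

lemma continuous_no_critical_strict_mono: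
  fixes f :: "real \<Rightarrow> real"
  assumes cont: "continuous_on {a..b} f"
    and diff: "\<And>x. a < x \<Longrightarrow> x < b \<Longrightarrow> f differentiable (at x)"
    and nocrit: "\<And>x. a < x \<Longrightarrow> x < b \<Longrightarrow> \<not> (f has_real_derivative 0) (at x)"
    and less: "f a < f b"
  shows "strict_mono_on {a..b} f"
proof -
  have ne: "f u \<noteq> f v" if "a \<le> u" "u < v" "v \<le> b" for u v
  proof
    assume "f u = f v"
    moreover have "continuous_on {u..v} f"
      using that by (intro continuous_on_subset[OF cont]) auto
    moreover have "f differentiable (at x)" if "u < x" "x < v" for x
      using diff[of x] that \<open>a \<le> u\<close> \<open>v \<le> b\<close> by simp
    ultimately obtain z where "u < z" "z < v" "DERIV f z :> 0"
      using Rolle[OF \<open>u < v\<close>, of f] by blast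
    then show False using nocrit[of z] that by auto
  qed
  have inj: "inj_on f {a..b}"
    by (intro linorder_inj_onI) (use ne in force)+
  show ?thesis
  proof (rule strict_mono_onI)
    fix u v assume uv: "u \<in> {a..b}" "v \<in> {a..b}" "u < v"
    have between: "f a < f x \<and> f x < f b" if "a < x" "x < b" for x
      using continuous_inj_imp_mono[OF that cont inj] less by auto
    show "f u < f v"
    proof (cases "a = u \<or> v = b")
      case True
      then show ?thesis using between less uv
        by (metis atLeastAtMost_iff order.order_iff_strict)
    next
      case False
      then have "a < u" "v < b" using uv by auto
      moreover have "continuous_on {a..v} f" "inj_on f {a..v}"
        using \<open>v < b\<close> by (auto intro: continuous_on_subset[OF cont] inj_on_subset[OF inj])
      ultimately show ?thesis
        using continuous_inj_imp_mono[of a u v f] between[of u] uv by auto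
    qed
  qed
qed

text \<open>
  The function vanishes at \<open>0\<close>, since \<open>p\<close> explodes there, and at \<open>q\<close>; it is positive in between and has
  no critical point besides the level.
\<close>

lemma american_put_level_unimodal:
  fixes p :: "real \<Rightarrow> real"
  assumes level: "american_put_level q p x0"
    and diff: "\<And>x. 0 < x \<Longrightarrow> x \<le> q \<Longrightarrow> p field_differentiable at x"
    and pos: "\<And>x. 0 < x \<Longrightarrow> x \<le> q \<Longrightarrow> 0 < p x"
    and at_0: "filterlim p at_top (at_right 0)"
  shows "strict_mono_on {0<..x0} (\<lambda>y. (q - y) / p y)"
    and "strict_antimono_on {x0..q} (\<lambda>y. (q - y) / p y)"
proof -
  define G where "G = (\<lambda>y. if y \<le> 0 then 0 else (q - y) / p y)"
  have x0: "0 < x0" "x0 < q"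
    and unique: "\<And>y. 0 < y \<Longrightarrow> y < q \<Longrightarrow> p y + (q - y) * deriv p y = 0 \<Longrightarrow> y = x0"
    using level by (auto simp: american_put_level_def american_put_equation_def)
  have D: "(G has_real_derivative - (p y + (q - y) * deriv p y) / (p y)\<^sup>2) (at y)"
    if y: "0 < y" "y \<le> q" for y
  proof -
    have "((\<lambda>y. (q - y) / p y) has_real_derivative - (p y + (q - y) * deriv p y) / (p y)\<^sup>2) (at y)"
      using field_differentiable_derivI[OF diff[OF y]] pos[OF y]
      by (auto intro!: derivative_eq_intros simp: power2_eq_square)
    moreover have "eventually (\<lambda>y. y \<in> {0<..}) (nhds y)"
      using y(1) by (intro eventually_nhds_in_open) auto
    then have ev: "eventually (\<lambda>y. (q - y) / p y = G y) (nhds y)"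
      by eventually_elim (auto simp: G_def)
    ultimately show ?thesis
      by (simp only: DERIV_cong_ev[OF refl ev refl])
  qed
  have nocrit: "\<not> (G has_real_derivative 0) (at y)" if y: "0 < y" "y < q" "y \<noteq> x0" for y
  proof
    assume "(G has_real_derivative 0) (at y)"
    with D[of y] y have "- (p y + (q - y) * deriv p y) / (p y)\<^sup>2 = 0"
      using DERIV_unique by fastforce
    with pos[of y] unique[of y] y show False by auto
  qed
  have "((\<lambda>y. (q - y) / p y) \<longlongrightarrow> 0) (at_right 0)"
    by (rule real_tendsto_divide_at_top[OF _ at_0, where c = q]) (auto intro!: tendsto_eq_intros)
  moreover have "eventually (\<lambda>y. (q - y) / p y = G y) (at_right 0)"
    unfolding eventually_at_right_field by (intro exI[of _ 1]) (auto simp: G_def)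
  ultimately have "(G \<longlongrightarrow> 0) (at_right 0)"
    using Lim_transform_eventually by blast
  then have G0: "(G \<longlongrightarrow> G 0) (at 0 within {0..q})"
    using x0 by (simp add: G_def at_within_Icc_at_right)
  have cont: "continuous_on {0..q} G"
    unfolding continuous_on_def
  proof
    fix y assume y: "y \<in> {0..q}"
    show "(G \<longlongrightarrow> G y) (at y within {0..q})"
    proof (cases "y = 0")
      case False
      with y D[of y] show ?thesis
        by (auto dest!: DERIV_isCont simp: isCont_def intro: tendsto_within_subset)
    qed (use G0 in simp)
  qed
  have Gx0: "0 < G x0"
    using pos[of x0] x0 by (simp add: G_def)
  have Gdiff: "G differentiable (at y)" if "0 < y" "y < q" for y
    using D[of y] that by (auto simp: real_differentiable_def)
  have "strict_mono_on {0..x0} G"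
  proof (rule continuous_no_critical_strict_mono)
    show "continuous_on {0..x0} G" using x0 by (intro continuous_on_subset[OF cont]) auto
    show "G 0 < G x0" using Gx0 by (simp add: G_def)
  qed (use nocrit Gdiff x0 in auto)
  then have "strict_mono_on {0<..x0} G"
    by (rule monotone_on_subset) auto
  then show "strict_mono_on {0<..x0} (\<lambda>y. (q - y) / p y)"
    by (simp add: monotone_on_def G_def)
  have "strict_mono_on {x0..q} (\<lambda>y. - G y)"
  proof (rule continuous_no_critical_strict_mono)
    show "continuous_on {x0..q} (\<lambda>y. - G y)"
      using x0 by (intro continuous_on_minus continuous_on_subset[OF cont]) auto
    show "- G x0 < - G q" using Gx0 x0 by (simp add: G_def)
    show "\<not> ((\<lambda>y. - G y) has_real_derivative 0) (at y)" if "x0 < y" "y < q" for y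
      using DERIV_minus[of "\<lambda>y. - G y" 0 y] nocrit[of y] that x0 by auto
  qed (use Gdiff x0 in auto)
  then show "strict_antimono_on {x0..q} (\<lambda>y. (q - y) / p y)"
    using x0 by (auto simp: monotone_on_def G_def)
qed

text \<open>
  With \<open>g\<^sub>i y = (q - y) / p\<^sub>i y\<close>, the monotone ratio says that \<open>g\<^sub>1 / g\<^sub>2 = p\<^sub>2 / p\<^sub>1\<close> is non-increasing.  So
  \<open>g\<^sub>1\<close> cannot still increase beyond the maximizer of \<open>g\<^sub>2\<close>.
\<close>

lemma american_put_formula_comparison:
  fixes p1 p2 :: "real \<Rightarrow> real"
  assumes level1: "american_put_level q p1 x01" and level2: "american_put_level q p2 x02"
    and D: "{0<..q} \<subseteq> D"
    and diff: "\<And>x. 0 < x \<Longrightarrow> p1 field_differentiable at x"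
      "\<And>x. 0 < x \<Longrightarrow> p2 field_differentiable at x"
    and pos: "\<And>x. x \<in> D \<Longrightarrow> 0 < p1 x" "\<And>x. x \<in> D \<Longrightarrow> 0 < p2 x"
    and at_0: "filterlim p1 at_top (at_right 0)" "filterlim p2 at_top (at_right 0)"
    and ratio: "\<And>y x. y \<in> D \<Longrightarrow> x \<in> D \<Longrightarrow> y \<le> x \<Longrightarrow> p2 x / p2 y \<le> p1 x / p1 y"
  shows "(\<forall>x\<in>D. american_put_formula q p2 x02 x \<le> american_put_formula q p1 x01 x) \<and> x01 \<le> x02"
proof -
  have x0: "0 < x01" "x01 < q" "0 < x02" "x02 < q"
    using level1 level2 by (auto simp: american_put_level_def)
  have inD: "x \<in> D" if "0 < x" "x \<le> q" for x
    using D that by auto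
  have inc1: "strict_mono_on {0<..x01} (\<lambda>y. (q - y) / p1 y)"
    and dec1: "strict_antimono_on {x01..q} (\<lambda>y. (q - y) / p1 y)"
    using american_put_level_unimodal[OF level1] diff pos at_0 inD by blast+
  have dec2: "strict_antimono_on {x02..q} (\<lambda>y. (q - y) / p2 y)"
    using american_put_level_unimodal[OF level2] diff pos at_0 inD by blast
  have level_le: "x01 \<le> x02"
  proof (rule ccontr)
    assume "\<not> ?thesis"
    then have less: "x02 < x01" by simp
    have p: "0 < p1 x01" "0 < p1 x02" "0 < p2 x01" "0 < p2 x02"
      using pos inD x0 by auto
    \<comment> \<open>The three monotonicity facts, cleared of denominators, form a strict cycle.\<close>
    have "(q - x01) * p2 x02 < (q - x02) * p2 x01"
      using monotone_onD[OF dec2, of x02 x01] less x0 p by (simp add: field_simps)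
    then have "(q - x01) * p2 x02 * p1 x02 < (q - x02) * p2 x01 * p1 x02"
      using p by simp
    also have "p2 x01 * p1 x02 \<le> p1 x01 * p2 x02"
      using ratio[of x02 x01] less inD x0 p by (simp add: field_simps)
    then have "(q - x02) * p2 x01 * p1 x02 \<le> (q - x02) * p1 x01 * p2 x02"
      using x0 mult_left_mono[of "p2 x01 * p1 x02" "p1 x01 * p2 x02" "q - x02"]
      by (simp add: mult.assoc)
    also have "(q - x02) * p1 x01 < (q - x01) * p1 x02"
      using strict_mono_onD[OF inc1, of x02 x01] less x0 p by (simp add: field_simps)
    then have "(q - x02) * p1 x01 * p2 x02 < (q - x01) * p1 x02 * p2 x02"
      using p by simp
    finally show False
      by (simp add: mult_ac)
  qed
  moreover have "american_put_formula q p2 x02 x \<le> american_put_formula q p1 x01 x" if x: "x \<in> D" for x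
  proof -
    have max1: "(q - y) / p1 y \<le> (q - x01) / p1 x01" if "x01 \<le> y" "y < q" for y
      using monotone_onD[OF dec1, of x01 y] that by (cases "y = x01") auto
    consider "x \<le> x01" | "x01 < x" "x \<le> x02" | "x02 < x" by linarith
    then show ?thesis
    proof cases
      case 1
      then show ?thesis using level_le by (simp add: american_put_formula_def)
    next
      case 2
      have "p1 x * ((q - x) / p1 x) \<le> p1 x * ((q - x01) / p1 x01)"
        using max1[of x] 2 x0 pos(1)[OF x] by (intro mult_left_mono) auto
      then show ?thesis
        using 2 pos(1)[OF x] by (simp add: american_put_formula_def mult.commute)
    next
      case 3
      have "(q - x02) * (p2 x / p2 x02) \<le> (q - x02) * (p1 x / p1 x02)"
        using ratio[of x02 x] 3 x x0 inD by (intro mult_left_mono) auto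
      also have "\<dots> = p1 x * ((q - x02) / p1 x02)" by simp
      also have "\<dots> \<le> p1 x * ((q - x01) / p1 x01)"
        using max1[of x02] level_le x0 pos(1)[OF x] by (intro mult_left_mono) auto
      finally show ?thesis
        using 3 level_le by (simp add: american_put_formula_def mult.commute)
    qed
  qed
  ultimately show ?thesis by blast
qed

section \<open>The barrier problem as an American put\<close>

text \<open>
  The positive decreasing solution on \<open>{0<..<d}\<close> that vanishes at \<open>d\<close>.  The trivial factor \<open>1\<close>
  makes it syntactically a linear combination.
\<close>

definition barrier_solution :: "(real \<Rightarrow> real) \<Rightarrow> (real \<Rightarrow> real) \<Rightarrow> real \<Rightarrow> real \<Rightarrow> real" where
  "barrier_solution \<psi> \<phi> d x = 1 * \<phi> x + (- (\<phi> d / \<psi> d)) * \<psi> x"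

context put_diffusion
begin

lemma barrier_solution_C2: "C2_on_pos (barrier_solution \<psi> \<phi> d)"
  unfolding barrier_solution_def by (intro C2_on_pos_lincomb psi_C2 phi_C2)

lemma barrier_solution_ode:
  "0 < x \<Longrightarrow> generator \<mu> \<sigma> (barrier_solution \<psi> \<phi> d) x = r * barrier_solution \<psi> \<phi> d x"
  using generator_lincomb[OF phi_C2 psi_C2, of x \<mu> \<sigma> 1 "- (\<phi> d / \<psi> d)"] psi_ode[of x] phi_ode[of x]
  unfolding barrier_solution_def by (simp add: algebra_simps)

lemma barrier_solution_decreasing:
  assumes "0 < d"
  shows "strict_antimono_on {0<..} (barrier_solution \<psi> \<phi> d)"
proof (rule monotone_onI)
  fix x y :: real assume xy: "x \<in> {0<..}" "y \<in> {0<..}" "x < y"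
  have "\<phi> y < \<phi> x" "\<psi> x < \<psi> y"
    using monotone_onD[OF phi_decreasing xy] strict_mono_onD[OF psi_increasing xy] .
  moreover from this have "\<phi> d / \<psi> d * \<psi> x \<le> \<phi> d / \<psi> d * \<psi> y"
    using phi_pos psi_pos assms by (intro mult_left_mono) (auto intro: less_imp_le divide_pos_pos)
  ultimately show "barrier_solution \<psi> \<phi> d y < barrier_solution \<psi> \<phi> d x"
    by (simp add: barrier_solution_def)
qed

lemma barrier_solution_at_barrier: "0 < d \<Longrightarrow> barrier_solution \<psi> \<phi> d d = 0"
  using psi_pos[of d] by (simp add: barrier_solution_def)

lemma barrier_solution_pos:
  assumes "0 < x" "x < d"
  shows "0 < barrier_solution \<psi> \<phi> d x"
  using monotone_onD[OF barrier_solution_decreasing, of d x d] barrier_solution_at_barrier[of d] assms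
  by auto

lemma barrier_solution_at_0: "filterlim (barrier_solution \<psi> \<phi> d) at_top (at_right 0)"
proof -
  have "((\<lambda>x. (- (\<phi> d / \<psi> d)) * \<psi> x) \<longlongrightarrow> (- (\<phi> d / \<psi> d)) * 0) (at_right 0)"
    by (intro tendsto_intros psi_at_0)
  from filterlim_tendsto_add_at_top[OF this phi_at_0] show ?thesis
    unfolding barrier_solution_def by (simp add: add.commute)
qed

lemma barrier_put_equation_iff_american:
  assumes "0 < y" "y < q" "0 < d"
  shows "barrier_put_equation q d \<psi> \<phi> y \<longleftrightarrow> american_put_equation q (barrier_solution \<psi> \<phi> d) y"
proof -
  have "((\<lambda>y. q - y) has_real_derivative - 1) (at y)"
    by (auto intro!: derivative_eq_intros)
  moreover have "eventually (\<lambda>y. y \<in> {..<q}) (nhds y)"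
    using assms by (intro eventually_nhds_in_open) auto
  then have ev: "eventually (\<lambda>y. q - y = put_payoff q y) (nhds y)"
    by eventually_elim (auto simp: put_payoff_def)
  ultimately have "(put_payoff q has_real_derivative - 1) (at y)"
    by (simp only: DERIV_cong_ev[OF refl ev refl])
  then have payoff': "deriv (put_payoff q) y = - 1"
    by (rule DERIV_imp_deriv)
  have payoff: "put_payoff q y = q - y"
    using assms by (simp add: put_payoff_def)
  have solution': "deriv (barrier_solution \<psi> \<phi> d) y = 1 * deriv \<phi> y + (- (\<phi> d / \<psi> d)) * deriv \<psi> y"
    unfolding barrier_solution_def using phi_C2 psi_C2 assms
    by (intro deriv_lincomb) (auto simp: C2_on_pos_def)
  have div: "z / (\<psi> d / \<phi> d) = \<phi> d / \<psi> d * z" for z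
    by simp
  show ?thesis
    unfolding barrier_put_equation_def american_put_equation_def payoff payoff' solution' div
    by (auto simp: barrier_solution_def algebra_simps diff_divide_distrib)
qed

lemma barrier_put_level_iff_american:
  assumes "0 < d"
  shows "barrier_put_level q d \<psi> \<phi> x0 \<longleftrightarrow> american_put_level q (barrier_solution \<psi> \<phi> d) x0"
  using barrier_put_equation_iff_american assms
  unfolding barrier_put_level_def american_put_level_def by auto

lemma barrier_put_formula_eq_american:
  assumes "0 < x" "0 < x0" "x0 < d"
  shows "barrier_put_formula q d \<psi> \<phi> x0 x = american_put_formula q (barrier_solution \<psi> \<phi> d) x0 x"
proof -
  have eq: "barrier_solution \<psi> \<phi> d y = \<phi> y * (\<psi> d / \<phi> d - \<psi> y / \<phi> y) / (\<psi> d / \<phi> d)" if "0 < y" for y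
    using psi_pos[of d] phi_pos[of d] phi_pos[of y] that assms
    by (simp add: barrier_solution_def field_simps)
  have "\<psi> d / \<phi> d \<noteq> 0"
    using psi_pos[of d] phi_pos[of d] assms by auto
  then have "barrier_solution \<psi> \<phi> d x / barrier_solution \<psi> \<phi> d x0
      = (\<phi> x / \<phi> x0) * ((\<psi> d / \<phi> d - \<psi> x / \<phi> x) / (\<psi> d / \<phi> d - \<psi> x0 / \<phi> x0))"
    unfolding eq[OF assms(1)] eq[OF assms(2)] by simp
  then show ?thesis
    by (simp add: barrier_put_formula_def american_put_formula_def)
qed

end

section \<open>Monotonicity in the drift\<close>

theorem proposition4p5:
  fixes M :: "'w measure" and F :: "ennreal \<Rightarrow> 'w measure" and B :: "real \<Rightarrow> 'w \<Rightarrow> real"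
    and r q :: real
    and \<sigma> \<mu>1 \<mu>2 :: "real \<Rightarrow> real"
    and X1 X2 :: "real \<Rightarrow> real \<Rightarrow> 'w \<Rightarrow> real"
    and \<psi>1 \<phi>1 \<psi>2 \<phi>2 :: "real \<Rightarrow> real"
  assumes diffusion1: "put_diffusion M F B r \<sigma> \<mu>1 X1 \<psi>1 \<phi>1"
    and diffusion2: "put_diffusion M F B r \<sigma> \<mu>2 X2 \<psi>2 \<phi>2"
    and strike: "0 < q"
  shows
    "(\<forall>d x01 x02.
       q < d \<and>
       barrier_put_level q d \<psi>1 \<phi>1 x01 \<and>
       (\<forall>x\<in>{0<..<d}. barrier_put_value M F r X1 q d x = barrier_put_formula q d \<psi>1 \<phi>1 x01 x) \<and>
       barrier_put_level q d \<psi>2 \<phi>2 x02 \<and>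
       (\<forall>x\<in>{0<..<d}. barrier_put_value M F r X2 q d x = barrier_put_formula q d \<psi>2 \<phi>2 x02 x) \<and>
       (\<forall>x\<in>{0<..<d}. \<mu>1 x \<le> \<mu>2 x)
       \<longrightarrow> (\<forall>x\<in>{0<..<d}. barrier_put_value M F r X1 q d x \<ge> barrier_put_value M F r X2 q d x)
           \<and> x01 \<le> x02) \<and>
     (\<forall>x01 x02.
       american_put_level q \<phi>1 x01 \<and>
       (\<forall>x\<in>{0<..}. american_put_value M F r X1 q x = american_put_formula q \<phi>1 x01 x) \<and>
       american_put_level q \<phi>2 x02 \<and>
       (\<forall>x\<in>{0<..}. american_put_value M F r X2 q x = american_put_formula q \<phi>2 x02 x) \<and>
       (\<forall>x\<in>{0<..}. \<mu>1 x \<le> \<mu>2 x)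
       \<longrightarrow> (\<forall>x\<in>{0<..}. american_put_value M F r X1 q x \<ge> american_put_value M F r X2 q x)
           \<and> x01 \<le> x02)"
proof -
  interpret d1: put_diffusion M F B r \<sigma> \<mu>1 X1 \<psi>1 \<phi>1 by (rule diffusion1)
  interpret d2: put_diffusion M F B r \<sigma> \<mu>2 X2 \<psi>2 \<phi>2 by (rule diffusion2)
  have barrier: "(\<forall>x\<in>{0<..<d}. barrier_put_formula q d \<psi>2 \<phi>2 x02 x \<le> barrier_put_formula q d \<psi>1 \<phi>1 x01 x)
      \<and> x01 \<le> x02"
    if qd: "q < d" and levels: "barrier_put_level q d \<psi>1 \<phi>1 x01" "barrier_put_level q d \<psi>2 \<phi>2 x02"
      and drift: "\<forall>x\<in>{0<..<d}. \<mu>1 x \<le> \<mu>2 x" for d x01 x02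
  proof -
    let ?p1 = "barrier_solution \<psi>1 \<phi>1 d" and ?p2 = "barrier_solution \<psi>2 \<phi>2 d"
    have d: "0 < d" using strike qd by simp
    have "(\<forall>x\<in>{0<..<d}. american_put_formula q ?p2 x02 x \<le> american_put_formula q ?p1 x01 x) \<and> x01 \<le> x02"
    proof (rule american_put_formula_comparison)
      show "american_put_level q ?p1 x01" "american_put_level q ?p2 x02"
        using levels d1.barrier_put_level_iff_american[OF d] d2.barrier_put_level_iff_american[OF d] by auto
      show "?p2 x / ?p2 y \<le> ?p1 x / ?p1 y" if "y \<in> {0<..<d}" "x \<in> {0<..<d}" "y \<le> x" for y x
      proof -
        have "?p2 x / ?p2 y \<le> ?p1 x / ?p1 y + 0"
          by (rule generator_comparison[where b = d, OF d1.r_pos _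
                d1.barrier_solution_C2 d1.barrier_solution_ode d1.barrier_solution_pos
                d2.barrier_solution_C2 d2.barrier_solution_ode d2.barrier_solution_pos
                d2.barrier_solution_decreasing])
            (use that drift d in
              \<open>auto simp: d1.barrier_solution_at_barrier d2.barrier_solution_at_barrier\<close>)
        then show ?thesis by simp
      qed
    qed (use qd d1.barrier_solution_C2 d2.barrier_solution_C2 d1.barrier_solution_pos
        d2.barrier_solution_pos d1.barrier_solution_at_0 d2.barrier_solution_at_0
        in \<open>auto simp: C2_on_pos_def\<close>)
    moreover have "0 < x01" "x01 < d" "0 < x02" "x02 < d"
      using levels qd by (auto simp: barrier_put_level_def)
    ultimately show ?thesis
      by (simp add: d1.barrier_put_formula_eq_american d2.barrier_put_formula_eq_american)
  qed
  have american: "(\<forall>x\<in>{0<..}. american_put_formula q \<phi>2 x02 x \<le> american_put_formula q \<phi>1 x01 x)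
      \<and> x01 \<le> x02"
    if levels: "american_put_level q \<phi>1 x01" "american_put_level q \<phi>2 x02"
      and drift: "\<forall>x\<in>{0<..}. \<mu>1 x \<le> \<mu>2 x" for x01 x02
  proof -
    have "\<phi>2 x / \<phi>2 y \<le> \<phi>1 x / \<phi>1 y" if xy: "y \<in> {0<..}" "x \<in> {0<..}" "y \<le> x" for y x
    proof (rule field_le_epsilon)
      fix e :: real assume e: "0 < e"
      have y: "0 < y" "0 < \<phi>1 y" "0 < \<phi>2 y" using xy d1.phi_pos d2.phi_pos by auto
      then have "0 < e * \<phi>2 y" using e by simp
      then have "eventually (\<lambda>b. \<phi>2 b < e * \<phi>2 y \<and> x \<le> b) at_top"
        using order_tendstoD(2)[OF d2.phi_at_infinity] eventually_ge_at_top eventually_conj by blast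
      then obtain b where b: "\<phi>2 b < e * \<phi>2 y" "x \<le> b"
        using eventually_happens'[OF trivial_limit_at_top_linorder] by blast
      \<comment> \<open>At \<open>b\<close> the second ratio is already below \<open>e\<close>, whatever the first one is.\<close>
      have ends: "\<phi>2 b / \<phi>2 y \<le> e" "0 \<le> \<phi>1 b / \<phi>1 y"
        using b y xy d1.phi_pos[of b] by (auto simp: field_simps less_imp_le)
      show "\<phi>2 x / \<phi>2 y \<le> \<phi>1 x / \<phi>1 y + e"
        by (rule generator_comparison[where b = b and ?\<mu>1.0 = \<mu>1 and ?\<mu>2.0 = \<mu>2, OF d1.r_pos y(1)
              d1.phi_C2 _ y(2) d2.phi_C2 _ y(3) d2.phi_decreasing])
          (use ends b e xy drift d1.phi_ode d2.phi_ode in auto)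
    qed
    then show ?thesis
      using d1.phi_C2 d2.phi_C2 d1.phi_pos d2.phi_pos d1.phi_at_0 d2.phi_at_0
      by (intro american_put_formula_comparison[OF levels]) (auto simp: C2_on_pos_def)
  qed
  show ?thesis
    using barrier american by auto
qed

end
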